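(* Let $2 \le D \le N$ be integers and $\alpha\in(0,1)$. Then \[ f_D(N,\alpha) \ge \frac{\alpha^2 N^2}{N + D} - \frac{\alpha N + 1}{D}. \] In particular, if $\alpha = \alpha(N)$ and $D = D(N)$ (with $2\le D\le N$) are such that $D\alpha \to \infty$ as $N \to \infty$, then $f_D(N,\alpha) \ge (1+o(1))\alpha^2 N$ as $N\to\infty$.
   Context: For a positive integer $N$, $[N] := \{1,2,\dots,N\}$. For a finite set $A$ of integers and an integer $d$, $r_{A-A}(d) := \#\{(a,a') \in A\times A : d = a - a'\}$. For $D > 1$, $M_D(A) := \max_{1 \le d < D} r_{A-A}(d)$. For positive integers $D \le N$ and $\alpha\in(0,1)$, $f_D(N,\alpha) := \min\{ M_D(A) : A \subseteq [N],\ |A| \ge \alpha N\}$. *)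

theory Defs
  imports Complex_Main "HOL-Library.Landau_Symbols"
begin

definition diff_rep :: "int set \<Rightarrow> int \<Rightarrow> nat" where
  "diff_rep A d = card {(a, a'). a \<in> A \<and> a' \<in> A \<and> d = a - a'}"

text \<open>Meaningful for \<open>D > 1\<close> only, since otherwise the maximum is over the empty set.\<close>

definition max_diff_rep :: "nat \<Rightarrow> int set \<Rightarrow> nat" where
  "max_diff_rep D A = Max {diff_rep A d | d. 1 \<le> d \<and> d < int D}"

definition min_max_diff_rep :: "nat \<Rightarrow> nat \<Rightarrow> real \<Rightarrow> nat" where
  "min_max_diff_rep D N \<alpha> =
     Min {max_diff_rep D A | A. A \<subseteq> {1..int N} \<and> real (card A) \<ge> \<alpha> * real N}"

end

theory Submission
  imports Defs "HOL-Analysis.Convex"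
begin

text \<open>
  Slide a window of length \<open>D\<close> over \<open>[N]\<close>: it has \<open>N + D\<close> positions, and on average it contains
  \<open>D |A| / (N + D)\<close> elements of \<open>A\<close>. The second moment of this count is at most
  \<open>D |A| + D\<^sup>2 M\<^sub>D(A)\<close>, because two distinct places of the window are both occupied
  for at most \<open>M\<^sub>D(A)\<close> positions. Cauchy-Schwarz compares the two.
  For the asymptotic statement \<open>D\<close> may be comparable to \<open>N\<close>, which would cost a constant factor;
  since \<open>M\<^sub>D(A)\<close> is monotone in \<open>D\<close>, one first shrinks \<open>D\<close> to at most about \<open>sqrt (N / \<alpha>)\<close>.
\<close>

lemma finite_diff_rep_values: "finite {diff_rep A d | d. 1 \<le> d \<and> d < int D}"
proof -
  have "{diff_rep A d | d. 1 \<le> d \<and> d < int D} = diff_rep A ` {1..<int D}"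
    by auto
  then show ?thesis by simp
qed

lemma diff_rep_le_max_diff_rep:
  assumes "1 \<le> d" "d < int D"
  shows "diff_rep A d \<le> max_diff_rep D A"
  unfolding max_diff_rep_def
  by (rule Max_ge[OF finite_diff_rep_values]) (use assms in auto)

lemma max_diff_rep_mono:
  assumes "2 \<le> D'" "D' \<le> D"
  shows "max_diff_rep D' A \<le> max_diff_rep D A"
  unfolding max_diff_rep_def
proof (rule Max_mono[OF _ _ finite_diff_rep_values])
  show "{diff_rep A d | d. 1 \<le> d \<and> d < int D'} \<subseteq> {diff_rep A d | d. 1 \<le> d \<and> d < int D}"
    using assms by force
  \<comment> \<open>\<open>Max\<close> is unspecified on the empty set; \<open>2 \<le> D'\<close>
    makes the difference 1 available.\<close>
  show "{diff_rep A d | d. 1 \<le> d \<and> d < int D'} \<noteq> {}"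
    using assms by (auto intro!: exI[of _ 1])
qed

text \<open>The competing values are finitely many, and \<alpha> \<le> 1 makes the whole interval
  admissible, so the minimum is over a nonempty finite set. Bounding it thus reduces to bounding
  \<open>max_diff_rep\<close> for a single set \<open>A\<close>.\<close>

lemma min_max_diff_rep_attained:
  assumes "\<alpha> \<le> 1"
  obtains A where "A \<subseteq> {1..int N}" "\<alpha> * real N \<le> real (card A)"
    "min_max_diff_rep D N \<alpha> = max_diff_rep D A"
proof -
  let ?S = "{max_diff_rep D A | A. A \<subseteq> {1..int N} \<and> real (card A) \<ge> \<alpha> * real N}"
  have "?S \<subseteq> max_diff_rep D ` Pow {1..int N}" by auto
  then have "finite ?S" by (rule finite_subset) simp
  moreover have "max_diff_rep D {1..int N} \<in> ?S"
    using mult_right_mono[OF assms, of "real N"] by (auto intro!: exI[of _ "{1..int N}"])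
  ultimately have "Min ?S \<in> ?S" by (intro Min_in) auto
  then show thesis using that unfolding min_max_diff_rep_def by blast
qed

text \<open>Each counted \<open>x\<close> yields the pair \<open>(x + j, x + i)\<close> representing
  \<open>j - i\<close> as a difference of elements of \<open>A\<close>, and distinct
  \<open>x\<close> yield distinct pairs. Both places lie below \<open>D\<close>, so the difference
  has absolute value between 1 and \<open>D - 1\<close>.\<close>

lemma card_common_translate_le:
  fixes A X :: "int set"
  assumes "finite A" "i \<noteq> j" "i < D" "j < D"
  shows "card {x \<in> X. x + int i \<in> A \<and> x + int j \<in> A} \<le> max_diff_rep D A"
proof -
  \<comment> \<open>Only positive differences enter \<open>max_diff_rep\<close>, so the places are
    ordered first; the other order follows by symmetry.\<close>
  have *: "card {x \<in> X. x + int k \<in> A \<and> x + int l \<in> A} \<le> max_diff_rep D A"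
    if "k < l" "l < D" for k l
  proof -
    let ?P = "{(a, a'). a \<in> A \<and> a' \<in> A \<and> int l - int k = a - a'}"
    have "finite ?P"
      by (rule finite_subset[of _ "A \<times> A"]) (use assms in auto)
    then have "card {x \<in> X. x + int k \<in> A \<and> x + int l \<in> A} \<le> card ?P"
      by (rule card_inj_on_le[where f = "\<lambda>x. (x + int l, x + int k)", rotated 2])
         (auto simp: inj_on_def)
    also have "\<dots> \<le> max_diff_rep D A"
      using diff_rep_le_max_diff_rep[of "int l - int k" D A] that by (simp add: diff_rep_def)
    finally show ?thesis .
  qed
  show ?thesis
    using *[of i j] *[of j i] assms by (cases "i < j") (auto simp: conj_commute)
qed

text \<open>This is the comparison of the two moments with denominators cleared. Expanding the
  square turns the second moment into a sum over pairs of places; diagonal pairs contribute the term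
  in \<open>card A\<close>, the others are controlled by
  \<open>card_common_translate_le\<close>.\<close>

lemma window_second_moment:
  fixes A :: "int set"
  assumes A: "A \<subseteq> {1..int N}"
  shows "(real D * real (card A))\<^sup>2
    \<le> (real N + real D) * (real D * real (card A) + (real D)\<^sup>2 * real (max_diff_rep D A))"
proof -
  \<comment> \<open>The left ends \<open>x\<close> of the windows \<open>x, ..., x + D - 1\<close>.
    For positive \<open>D\<close> the position \<open>x = 1 - D\<close> misses \<open>[N]\<close>;
    with it the count is exactly \<open>N + D\<close>.\<close>
  define X where "X = {- int D<..int N}"
  define M where "M = max_diff_rep D A"
  define h where "h i x = (if x + int i \<in> A then 1 else 0 :: real)" for i x
  have finA: "finite A" using A finite_subset by blast
  have finX: "finite X" by (simp add: X_def)
  have cardX: "real (card X) = real N + real D" by (simp add: X_def)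
  have h1: "(\<Sum>x\<in>X. h i x) = real (card A)" if "i < D" for i
  proof -
    \<comment> \<open>No element is lost at the boundary: for \<open>a\<close> in \<open>[N]\<close>
      and \<open>i < D\<close>, the position \<open>a - i\<close> lies above \<open>- D\<close> and
      is at most \<open>N\<close>.\<close>
    have "{x \<in> X. x + int i \<in> A} = (\<lambda>a. a - int i) ` A"
      using A that by (force simp: X_def image_iff)
    then have "card {x \<in> X. x + int i \<in> A} = card A"
      by (simp add: card_image inj_on_def)
    then show ?thesis
      unfolding h_def using finX by (simp add: sum.If_cases Int_def)
  qed
  \<comment> \<open>Adding \<open>M\<close> on the diagonal as well gives the uniform total
    \<open>D^2 * M\<close> in place of \<open>D * (D - 1) * M\<close>.\<close>
  have h2: "(\<Sum>x\<in>X. h i x * h j x) \<le> (if i = j then real (card A) else 0) + real M"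
    if "i < D" "j < D" for i j
  proof (cases "i = j")
    case True
    have "(\<Sum>x\<in>X. h i x * h j x) = (\<Sum>x\<in>X. h i x)"
      using True by (intro sum.cong) (auto simp: h_def)
    then show ?thesis using True h1 that by simp
  next
    case False
    have "(\<Sum>x\<in>X. h i x * h j x)
        = (\<Sum>x\<in>X. if x + int i \<in> A \<and> x + int j \<in> A then 1 else 0)"
      by (intro sum.cong) (auto simp: h_def)
    also have "\<dots> = real (card {x \<in> X. x + int i \<in> A \<and> x + int j \<in> A})"
      using finX by (simp add: sum.If_cases Int_def)
    finally show ?thesis
      using card_common_translate_le[OF finA False that, of X] False by (simp add: M_def)
  qed
  have "real D * real (card A) = (\<Sum>i<D. \<Sum>x\<in>X. h i x)"
    by (simp add: h1)
  also have "\<dots> = (\<Sum>x\<in>X. \<Sum>i<D. h i x)"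
    by (rule sum.swap)
  finally have "(real D * real (card A))\<^sup>2 = (\<Sum>x\<in>X. \<Sum>i<D. h i x)\<^sup>2"
    by simp
  also have "\<dots> \<le> real (card X) * (\<Sum>x\<in>X. (\<Sum>i<D. h i x)\<^sup>2)"
    \<comment> \<open>Pairing the window counts with the constant 1 produces the factor
      \<open>card X\<close>.\<close>
    using Cauchy_Schwarz_ineq_sum[of "\<lambda>_. 1" "\<lambda>x. \<Sum>i<D. h i x" X] by simp
  also have "(\<Sum>x\<in>X. (\<Sum>i<D. h i x)\<^sup>2) = (\<Sum>x\<in>X. \<Sum>i<D. \<Sum>j<D. h i x * h j x)"
    by (simp add: power2_eq_square sum_product)
  also have "\<dots> = (\<Sum>i<D. \<Sum>j<D. \<Sum>x\<in>X. h i x * h j x)"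
    by (subst sum.swap, rule sum.cong[OF refl], rule sum.swap)
  also have "real (card X) * \<dots>
      \<le> real (card X) * (\<Sum>i<D. \<Sum>j<D. (if i = j then real (card A) else 0) + real M)"
    by (intro mult_left_mono sum_mono h2) auto
  also have "(\<Sum>i<D. \<Sum>j<D. (if i = j then real (card A) else 0) + real M)
      = real D * real (card A) + (real D)\<^sup>2 * real M"
    by (simp add: sum.distrib power2_eq_square distrib_left)
  finally show ?thesis by (simp add: cardX M_def)
qed

text \<open>The parameter \<open>t\<close> allows the bound to be stated with \<alpha> N although
  \<open>card A\<close> may be larger. Some care is needed because the left side is not increasing
  in \<open>t\<close> near 0.\<close>

lemma max_diff_rep_lower_bound:
  fixes A :: "int set"
  assumes A: "A \<subseteq> {1..int N}" and D: "0 < D" and t: "0 \<le> t" "t \<le> real (card A)"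
  shows "t\<^sup>2 / (real N + real D) - t / real D \<le> real (max_diff_rep D A)"
proof -
  define m M where "m = real (card A)" and "M = real (max_diff_rep D A)"
  define d s where "d = real D" and "s = real N + real D"
  have pos: "0 < d" "0 < s" using D by (auto simp: d_def s_def)
  have "(d * m)\<^sup>2 \<le> s * (d * m + d\<^sup>2 * M)"
    using window_second_moment[OF A, of D] by (simp add: m_def M_def d_def s_def)
  then have "d * (d * m\<^sup>2) \<le> d * (s * (m + d * M))"
    by (simp add: power2_eq_square algebra_simps)
  then have "d * m\<^sup>2 \<le> s * (m + d * M)"
    using pos by simp
  then have bound: "m * (d * m - s) \<le> s * d * M"
    by (simp add: power2_eq_square algebra_simps)
  have "t * (d * t - s) \<le> s * d * M"
  \<comment> \<open>Up to the root \<open>t = s / d\<close> the left side is at most 0 and the claim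
    is trivial; beyond it both factors are nonnegative and increasing in \<open>t\<close>, so
    \<open>t\<close> may be replaced by \<open>m\<close>.\<close>
  proof (cases "d * t \<le> s")
    case True
    then have "t * (d * t - s) \<le> 0" using t by (simp add: mult_nonneg_nonpos)
    moreover have "0 \<le> s * d * M" using pos by (simp add: M_def)
    ultimately show ?thesis by linarith
  next
    case False
    have "t \<le> m" using t by (simp add: m_def)
    then have "t * (d * t - s) \<le> m * (d * m - s)"
      using False t pos by (intro mult_mono) auto
    then show ?thesis using bound by linarith
  qed
  then have "t\<^sup>2 / s - t / d \<le> M"
    using pos by (simp add: field_simps power2_eq_square)
  then show ?thesis by (simp add: M_def d_def s_def)
qed

text \<open>A minimiser for \<open>D\<close> is tested with the shorter window \<open>D'\<close>,
  and monotonicity returns to \<open>D\<close>. Taking \<open>D' = D\<close> gives the explicit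
  bound; the freedom in \<open>D'\<close> serves the asymptotic one.\<close>

lemma min_max_diff_rep_lower_bound:
  assumes "2 \<le> D'" "D' \<le> D" "0 < \<alpha>" "\<alpha> < 1"
  shows "(\<alpha> * real N)\<^sup>2 / (real N + real D') - \<alpha> * real N / real D'
    \<le> real (min_max_diff_rep D N \<alpha>)"
proof -
  obtain A where A: "A \<subseteq> {1..int N}" "\<alpha> * real N \<le> real (card A)"
    "min_max_diff_rep D N \<alpha> = max_diff_rep D A"
    using min_max_diff_rep_attained assms(4) by (metis less_imp_le)
  have "(\<alpha> * real N)\<^sup>2 / (real N + real D') - \<alpha> * real N / real D' \<le> real (max_diff_rep D' A)"
    using max_diff_rep_lower_bound[OF A(1) _ _ A(2), of D'] assms by simp
  also have "\<dots> \<le> real (max_diff_rep D A)"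
    using max_diff_rep_mono[OF assms(1,2)] by simp
  finally show ?thesis using A(3) by simp
qed

text \<open>With a window of length \<open>E\<close>, the lower bound divided by \<alpha>^2 N is
  \<open>1 / (1 + E / N)\<close> minus \<open>1 / (E \<alpha>)\<close>. This tends to 1 once
  \<open>E / N\<close> tends to 0 and \<open>E \<alpha>\<close> tends to infinity, so
  \<open>E\<close> is chosen to achieve both.\<close>

lemma min_max_diff_rep_asymptotic:
  fixes D :: "nat \<Rightarrow> nat" and \<alpha> :: "nat \<Rightarrow> real"
  assumes range: "\<And>N. 2 \<le> N \<Longrightarrow> 2 \<le> D N \<and> D N \<le> N \<and> 0 < \<alpha> N \<and> \<alpha> N < 1"
    and lim: "filterlim (\<lambda>N. real (D N) * \<alpha> N) at_top sequentially"
  obtains \<epsilon> :: "nat \<Rightarrow> real" where "\<epsilon> \<longlonglongrightarrow> 0"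
    "\<And>N. 2 \<le> N \<Longrightarrow> (1 + \<epsilon> N) * (\<alpha> N)\<^sup>2 * real N \<le> real (min_max_diff_rep (D N) N (\<alpha> N))"
proof -
  \<comment> \<open>The length \<open>sqrt (N / \<alpha>)\<close> balances the two errors:
    \<open>E / N\<close> and \<open>1 / (E \<alpha>)\<close> both become
    \<open>1 / sqrt (\<alpha> N)\<close>. The minimum with \<open>D N\<close> keeps the window
    admissible.\<close>
  define E where "E N = min (D N) (nat \<lceil>sqrt (real N / \<alpha> N)\<rceil>)" for N
  have E: "2 \<le> E N" "E N \<le> D N" "real (E N) / real N \<le> 1 / sqrt (\<alpha> N * real N) + 1 / real N"
    "min (real (D N) * \<alpha> N) (sqrt (\<alpha> N * real N)) \<le> real (E N) * \<alpha> N"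
    if N: "2 \<le> N" for N
  proof -
    define a n where "a = \<alpha> N" and "n = real N"
    have a: "0 < a" "a < 1" and n: "0 < n" "1 < n" using range[OF N] N by (auto simp: a_def n_def)
    \<comment> \<open>The strict inequality matters: rounding up a number above 1 gives at least 2,
      the smallest admissible window length.\<close>
    have "1 < n / a" using a n by (simp add: field_simps)
    then have gt1: "1 < sqrt (n / a)" by simp
    then have "2 \<le> nat \<lceil>sqrt (n / a)\<rceil>" by linarith
    then show "2 \<le> E N" using range[OF N] by (simp add: E_def a_def n_def)
    show "E N \<le> D N" by (simp add: E_def)
    have c: "real (nat \<lceil>sqrt (n / a)\<rceil>) = of_int \<lceil>sqrt (n / a)\<rceil>"
      using gt1 by simp
    have "real (E N) \<le> real (nat \<lceil>sqrt (n / a)\<rceil>)" by (simp add: E_def a_def n_def)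
    also have "\<dots> \<le> sqrt (n / a) + 1" unfolding c by linarith
    finally have "real (E N) / n \<le> (sqrt (n / a) + 1) / n" using n by (simp add: divide_right_mono)
    also have "\<dots> = 1 / sqrt (a * n) + 1 / n"
    proof -
      have "sqrt (n / a) * sqrt (a * n) = n"
        using a n by (simp flip: real_sqrt_mult)
      then have "sqrt (n / a) / n = 1 / sqrt (a * n)"
        using a n by (simp add: field_simps)
      then show ?thesis by (simp add: add_divide_distrib)
    qed
    finally show "real (E N) / real N \<le> 1 / sqrt (\<alpha> N * real N) + 1 / real N"
      by (simp add: a_def n_def)
    have "sqrt (n / a) * a = sqrt (a * n)"
    proof -
      have "sqrt (n / a) * sqrt (a * a) = sqrt (n / a * (a * a))" by (simp only: real_sqrt_mult)
      moreover have "n / a * (a * a) = a * n" using a by simp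
      ultimately show ?thesis using a by simp
    qed
    moreover have "sqrt (n / a) * a \<le> real (nat \<lceil>sqrt (n / a)\<rceil>) * a"
      unfolding c using a by (intro mult_right_mono) auto
    ultimately show "min (real (D N) * \<alpha> N) (sqrt (\<alpha> N * real N)) \<le> real (E N) * \<alpha> N"
      by (auto simp: E_def a_def n_def min_def)
  qed
  \<comment> \<open>Since \<open>D N \<le> N\<close>, the divergence of \<open>D \<alpha>\<close>
    forces that of \<open>\<alpha> N\<close>.\<close>
  have limN: "filterlim (\<lambda>N. \<alpha> N * real N) at_top sequentially"
  proof (rule filterlim_at_top_mono[OF lim])
    show "\<forall>\<^sub>F N in sequentially. real (D N) * \<alpha> N \<le> \<alpha> N * real N"
      using eventually_ge_at_top[of 2]
    proof eventually_elim
      case (elim N)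
      then show ?case using range[OF elim] by (simp add: mult.commute)
    qed
  qed
  have limsqrt: "filterlim (\<lambda>N. sqrt (\<alpha> N * real N)) at_top sequentially"
    by (rule filterlim_compose[OF sqrt_at_top limN])
  have limE\<alpha>: "filterlim (\<lambda>N. real (E N) * \<alpha> N) at_top sequentially"
    unfolding filterlim_at_top
  proof
    fix Z :: real
    have "\<forall>\<^sub>F N in sequentially. Z \<le> real (D N) * \<alpha> N"
      "\<forall>\<^sub>F N in sequentially. Z \<le> sqrt (\<alpha> N * real N)"
      using lim limsqrt by (simp_all add: filterlim_at_top)
    then show "\<forall>\<^sub>F N in sequentially. Z \<le> real (E N) * \<alpha> N"
      using eventually_ge_at_top[of 2]
    proof eventually_elim
      case (elim N)
      then show ?case using E(4)[of N] by linarith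
    qed
  qed
  have "(\<lambda>N. 1 / sqrt (\<alpha> N * real N) + 1 / real N) \<longlonglongrightarrow> 0 + 0"
    by (intro tendsto_add tendsto_divide_0[OF tendsto_const]
        filterlim_at_top_imp_at_infinity limsqrt filterlim_real_sequentially)
  then have lim0: "(\<lambda>N. 1 / sqrt (\<alpha> N * real N) + 1 / real N) \<longlonglongrightarrow> 0"
    by simp
  \<comment> \<open>The cap in \<open>E\<close> enters here: for \<open>D\<close> comparable to
    \<open>N\<close> the uncapped ratio would stay away from 0.\<close>
  have limEN: "(\<lambda>N. real (E N) / real N) \<longlonglongrightarrow> 0"
    by (rule tendsto_sandwich[OF _ _ tendsto_const lim0])
       (auto intro!: eventually_sequentiallyI[of 2] E(3))
  \<comment> \<open>Chosen so that, for \<open>N \<ge> 2\<close>,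
    \<open>(1 + \<epsilon>) \<alpha>^2 N\<close> is exactly the explicit lower bound with window
    length \<open>E N\<close>.\<close>
  define \<epsilon> where "\<epsilon> N = 1 / (1 + real (E N) / real N) - 1 / (real (E N) * \<alpha> N) - 1" for N
  have "\<epsilon> \<longlonglongrightarrow> 1 / (1 + 0) - 0 - 1"
    unfolding \<epsilon>_def
    by (intro tendsto_intros limEN tendsto_divide_0[OF tendsto_const]
        filterlim_at_top_imp_at_infinity limE\<alpha>) auto
  then have "\<epsilon> \<longlonglongrightarrow> 0" by simp
  moreover have "(1 + \<epsilon> N) * (\<alpha> N)\<^sup>2 * real N \<le> real (min_max_diff_rep (D N) N (\<alpha> N))"
    if N: "2 \<le> N" for N
  proof -
    define a n e where "a = \<alpha> N" and "n = real N" and "e = real (E N)"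
    have pos: "0 < a" "0 < n" "0 < e"
      using range[OF N] E(1)[OF N] N by (auto simp: a_def n_def e_def)
    have "1 / (1 + e / n) = n / (n + e)" using pos by (simp add: field_simps)
    then have "(1 + \<epsilon> N) * a\<^sup>2 * n = (n / (n + e) - 1 / (e * a)) * a\<^sup>2 * n"
      by (simp add: \<epsilon>_def a_def n_def e_def)
    also have "\<dots> = (a * n)\<^sup>2 / (n + e) - a * n / e"
      using pos by (simp add: left_diff_distrib power2_eq_square)
    also have "\<dots> \<le> real (min_max_diff_rep (D N) N a)"
      using min_max_diff_rep_lower_bound[OF E(1)[OF N] E(2)[OF N]] range[OF N]
      by (simp add: a_def n_def e_def)
    finally show ?thesis by (simp add: a_def n_def)
  qed
  ultimately show thesis by (rule that)
qed

theorem theorem3p1: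
  "(\<forall>(D::nat) (N::nat) (\<alpha>::real). 2 \<le> D \<and> D \<le> N \<and> 0 < \<alpha> \<and> \<alpha> < 1 \<longrightarrow>
      real (min_max_diff_rep D N \<alpha>)
        \<ge> \<alpha>\<^sup>2 * (real N)\<^sup>2 / (real N + real D) - (\<alpha> * real N + 1) / real D)
   \<and>
   (\<forall>(D::nat \<Rightarrow> nat) (\<alpha>::nat \<Rightarrow> real).
      (\<forall>N\<ge>2. 2 \<le> D N \<and> D N \<le> N \<and> 0 < \<alpha> N \<and> \<alpha> N < 1) \<and>
      filterlim (\<lambda>N. real (D N) * \<alpha> N) at_top sequentially \<longrightarrow>
      (\<exists>\<epsilon>::nat \<Rightarrow> real. \<epsilon> \<in> o[sequentially](\<lambda>_. 1) \<and>
         (\<forall>\<^sub>F N in sequentially.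
            real (min_max_diff_rep (D N) N (\<alpha> N)) \<ge> (1 + \<epsilon> N) * (\<alpha> N)\<^sup>2 * real N)))"
proof (intro conjI allI impI; elim conjE)
  fix D N :: nat and \<alpha> :: real
  assume "2 \<le> D" "D \<le> N" "0 < \<alpha>" "\<alpha> < 1"
  then have "(\<alpha> * real N)\<^sup>2 / (real N + real D) - \<alpha> * real N / real D
      \<le> real (min_max_diff_rep D N \<alpha>)"
    by (intro min_max_diff_rep_lower_bound) auto
  \<comment> \<open>The bound just obtained is stronger than the stated one by
    \<open>1 / D\<close>.\<close>
  moreover have "\<alpha> * real N / real D \<le> (\<alpha> * real N + 1) / real D"
    by (simp add: divide_right_mono)
  ultimately show "\<alpha>\<^sup>2 * (real N)\<^sup>2 / (real N + real D) - (\<alpha> * real N + 1) / real D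
      \<le> real (min_max_diff_rep D N \<alpha>)"
    by (simp add: power_mult_distrib)
next
  fix D :: "nat \<Rightarrow> nat" and \<alpha> :: "nat \<Rightarrow> real"
  assume range: "\<forall>N\<ge>2. 2 \<le> D N \<and> D N \<le> N \<and> 0 < \<alpha> N \<and> \<alpha> N < 1"
    and lim: "filterlim (\<lambda>N. real (D N) * \<alpha> N) at_top sequentially"
  obtain \<epsilon> :: "nat \<Rightarrow> real" where "\<epsilon> \<longlonglongrightarrow> 0"
    "\<And>N. 2 \<le> N \<Longrightarrow> (1 + \<epsilon> N) * (\<alpha> N)\<^sup>2 * real N \<le> real (min_max_diff_rep (D N) N (\<alpha> N))"
    using min_max_diff_rep_asymptotic[OF _ lim] range by blast
  then show "\<exists>\<epsilon>. \<epsilon> \<in> o[sequentially](\<lambda>_. 1) \<and>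
      (\<forall>\<^sub>F N in sequentially.
        (1 + \<epsilon> N) * (\<alpha> N)\<^sup>2 * real N \<le> real (min_max_diff_rep (D N) N (\<alpha> N)))"
    by (intro exI[of _ \<epsilon>]) (auto intro!: smalloI_tendsto eventually_sequentiallyI[of 2])
qed

end
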